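(* Let $(a_n)_{n\in\mathbb{N}}$ and $(b_{n,j})_{n,j\in\mathbb{N}}$ be real numbers with $a_n\ge 0$ for all $n$, $b_{n,j}\ge 0$ for all $n,j$, and $b_{n,j}=0$ whenever $n\ge j$. Let $w$ be a weight such that $w_n\ge n$ for all $n\in\mathbb{N}$ and such that there exists $\kappa\in(0,1]$ with $\sum_{n=1}^{j-1}w_nb_{n,j}\le\kappa w_j$ for all $j=2,3,\ldots$. Let $G^{(w)}=\overline{A^{(w)}+B^{(w)}}$. Then, for all $g\in\mathcal{D}(G^{(w)})$, we have $$\bigl[G^{(w)}g\bigr]_n=-a_ng_n+\sum_{j=n+1}^\infty a_jb_{n,j}g_j,\qquad n\in\mathbb{N}.$$
   Context: $\mathbb{N}=\{1,2,\ldots\}$. A weight is a sequence $w=(w_n)_{n=1}^\infty$ of strictly positive reals, and $\ell_w^1$ is the Banach space of real sequences $f=(f_n)_{n=1}^\infty$ with $\|f\|_w=\sum_{n=1}^\infty w_n|f_n|<\infty$. Operators: $A^{(w)}f=(-a_nf_n)_{n=1}^\infty$ with $\mathcal{D}(A^{(w)})=\{f\in\ell_w^1:(a_nf_n)_n\in\ell_w^1\}$; $B^{(w)}f=\bigl(\sum_{j=n+1}^\infty a_jb_{n,j}f_j\bigr)_{n=1}^\infty$ with $\mathcal{D}(B^{(w)})$ the set of $f\in\ell_w^1$ for which this sequence is well defined and lies in $\ell_w^1$; the sum $A^{(w)}+B^{(w)}$ has domain $\mathcal{D}(A^{(w)})\cap\mathcal{D}(B^{(w)})$. Under the stated hypotheses,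 $A^{(w)}+B^{(w)}$ is closable and its closure $G^{(w)}$ generates a substochastic $C_0$-semigroup on $\ell_w^1$ (positive, and contractive on the cone of componentwise non-negative sequences). *)

theory Defs
  imports "HOL-Analysis.Analysis"
begin

text \<open>
  A real sequence indexed by 1, 2, 3, ... is represented by a function on \<^typ>\<open>nat\<close> that is
  normalised to be 0 at the unused index 0, so that distinct functions in the space below are
  distinct sequences and the weighted norm is a genuine norm.  The values of coefficient families
  and weights at index 0 are never used.
\<close>

definition l1w :: "(nat \<Rightarrow> real) \<Rightarrow> (nat \<Rightarrow> real) set" where
  "l1w w = {f. f 0 = 0 \<and> (\<lambda>n. w n * \<bar>f n\<bar>) summable_on {1..}}"

definition normw :: "(nat \<Rightarrow> real) \<Rightarrow> (nat \<Rightarrow> real) \<Rightarrow> real" where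
  "normw w f = (\<Sum>\<^sub>\<infinity>n\<in>{1..}. w n * \<bar>f n\<bar>)"

definition distw :: "(nat \<Rightarrow> real) \<Rightarrow> (nat \<Rightarrow> real) \<Rightarrow> (nat \<Rightarrow> real) \<Rightarrow> real" where
  "distw w f g = normw w (\<lambda>n. f n - g n)"

definition topw :: "(nat \<Rightarrow> real) \<Rightarrow> (nat \<Rightarrow> real) topology" where
  "topw w = Metric_space.mtopology (l1w w) (distw w)"

lemma l1w_diff:
  assumes w: "\<And>n. n \<ge> 1 \<Longrightarrow> w n > 0" and "f \<in> l1w w" "g \<in> l1w w"
  shows "(\<lambda>n. f n - g n) \<in> l1w w"
proof -
  have "(\<lambda>n. w n * \<bar>f n\<bar> + w n * \<bar>g n\<bar>) summable_on {1..}"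
    using assms(2,3) by (intro summable_on_add) (auto simp: l1w_def)
  moreover have "0 \<le> w n * \<bar>f n - g n\<bar> \<and> w n * \<bar>f n - g n\<bar> \<le> w n * \<bar>f n\<bar> + w n * \<bar>g n\<bar>"
    if "n \<in> {1..}" for n
  proof -
    have "w n * \<bar>f n - g n\<bar> \<le> w n * (\<bar>f n\<bar> + \<bar>g n\<bar>)"
      using w[of n] that by (intro mult_left_mono) auto
    then show ?thesis using w[of n] that by (auto simp: distrib_left)
  qed
  ultimately have "(\<lambda>n. w n * \<bar>f n - g n\<bar>) summable_on {1..}"
    by (auto intro: summable_on_comparison_test[where f = "\<lambda>n. w n * \<bar>f n\<bar> + w n * \<bar>g n\<bar>"])
  then show ?thesis using assms(2,3) by (auto simp: l1w_def)
qed

lemma Metric_space_l1w: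
  assumes w: "\<And>n. n \<ge> 1 \<Longrightarrow> w n > 0"
  shows "Metric_space (l1w w) (distw w)"
proof
  fix f g h
  show "0 \<le> distw w f g"
    unfolding distw_def normw_def using w by (intro infsum_nonneg) (simp add: less_imp_le)
  show "distw w f g = distw w g f"
    by (simp add: distw_def normw_def abs_minus_commute)
  show "distw w f g = 0 \<longleftrightarrow> f = g" if "f \<in> l1w w" "g \<in> l1w w"
  proof
    assume "distw w f g = 0"
    then have i: "(\<Sum>\<^sub>\<infinity>n\<in>{1..}. w n * \<bar>f n - g n\<bar>) \<le> 0"
      by (simp add: distw_def normw_def)
    have m: "(\<lambda>n. w n * \<bar>f n - g n\<bar>) summable_on {1..}"
      using l1w_diff[OF w that] by (simp add: l1w_def)
    have p: "0 \<le> w n * \<bar>f n - g n\<bar>" if "n \<in> {1..}" for n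
      using w[of n] that by simp
    have z: "w n * \<bar>f n - g n\<bar> = 0" if "n \<in> {1..}" for n
      by (rule nonneg_infsum_le_0D[OF i m p that])
    have "f n = g n" if "n \<ge> 1" for n using w[OF that] z[of n] that by simp
    moreover have "f 0 = g 0" using that by (simp add: l1w_def)
    ultimately have "f n = g n" for n by (cases "n = 0") auto
    then show "f = g" by blast
  qed (simp add: distw_def normw_def)
  show "distw w f h \<le> distw w f g + distw w g h"
    if f: "f \<in> l1w w" and g: "g \<in> l1w w" and h: "h \<in> l1w w"
  proof -
    have s: "(\<lambda>n. w n * \<bar>x n - y n\<bar>) summable_on {1..}" if "x \<in> l1w w" "y \<in> l1w w" for x y
      using l1w_diff[OF w that] by (simp add: l1w_def)
    have "distw w f h \<le> (\<Sum>\<^sub>\<infinity>n\<in>{1..}. w n * \<bar>f n - g n\<bar> + w n * \<bar>g n - h n\<bar>)"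
      unfolding distw_def normw_def
    proof (rule infsum_mono)
      fix n :: nat assume "n \<in> {1..}"
      then have "w n * \<bar>f n - h n\<bar> \<le> w n * (\<bar>f n - g n\<bar> + \<bar>g n - h n\<bar>)"
        using w[of n] by (intro mult_left_mono) auto
      then show "w n * \<bar>f n - h n\<bar> \<le> w n * \<bar>f n - g n\<bar> + w n * \<bar>g n - h n\<bar>"
        by (simp only: distrib_left)
    qed (intro s f h summable_on_add g)+
    also have "\<dots> = distw w f g + distw w g h"
      unfolding distw_def normw_def by (intro infsum_add s f g h)
    finally show ?thesis .
  qed
qed

text \<open>A partially defined operator; values of \<open>op_app\<close> outside \<open>op_dom\<close> are irrelevant.\<close>

record seq_operator =
  op_dom :: "(nat \<Rightarrow> real) set"
  op_app :: "(nat \<Rightarrow> real) \<Rightarrow> nat \<Rightarrow> real"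

definition op_add :: "seq_operator \<Rightarrow> seq_operator \<Rightarrow> seq_operator" where
  "op_add S T = \<lparr>op_dom = op_dom S \<inter> op_dom T, op_app = (\<lambda>f n. op_app S f n + op_app T f n)\<rparr>"

definition op_graph :: "seq_operator \<Rightarrow> ((nat \<Rightarrow> real) \<times> (nat \<Rightarrow> real)) set" where
  "op_graph T = {(f, op_app T f) |f. f \<in> op_dom T}"

definition closure_graph ::
  "(nat \<Rightarrow> real) \<Rightarrow> seq_operator \<Rightarrow> ((nat \<Rightarrow> real) \<times> (nat \<Rightarrow> real)) set" where
  "closure_graph w T = (prod_topology (topw w) (topw w)) closure_of (op_graph T)"

text \<open>
  The closure of a closable operator: the operator whose graph is the closure of the graph.
  Closability says that the closed graph is single-valued, so that the definite description below
  denotes.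
\<close>

definition op_closure :: "(nat \<Rightarrow> real) \<Rightarrow> seq_operator \<Rightarrow> seq_operator" where
  "op_closure w T = \<lparr>op_dom = Domain (closure_graph w T),
                     op_app = (\<lambda>f. THE h. (f, h) \<in> closure_graph w T)\<rparr>"

definition A_op :: "(nat \<Rightarrow> real) \<Rightarrow> (nat \<Rightarrow> real) \<Rightarrow> seq_operator" where
  "A_op w a = \<lparr>op_dom = {f \<in> l1w w. (\<lambda>n. a n * f n) \<in> l1w w},
               op_app = (\<lambda>f n. - a n * f n)\<rparr>"

text \<open>
  The series over \<open>j \<ge> n + 1\<close> are ordinary (ordered) series, written with \<open>j = n + 1 + i\<close>; the
  image sequence is well defined iff all of them converge.
\<close>

definition B_seq :: "(nat \<Rightarrow> real) \<Rightarrow> (nat \<Rightarrow> nat \<Rightarrow> real) \<Rightarrow> (nat \<Rightarrow> real) \<Rightarrow> nat \<Rightarrow> real" where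
  "B_seq a b f n =
     (if n = 0 then 0 else (\<Sum>i. a (n + 1 + i) * b n (n + 1 + i) * f (n + 1 + i)))"

definition B_op :: "(nat \<Rightarrow> real) \<Rightarrow> (nat \<Rightarrow> real) \<Rightarrow> (nat \<Rightarrow> nat \<Rightarrow> real) \<Rightarrow> seq_operator" where
  "B_op w a b =
     \<lparr>op_dom = {f \<in> l1w w. (\<forall>n\<ge>1. summable (\<lambda>i. a (n + 1 + i) * b n (n + 1 + i) * f (n + 1 + i)))
                           \<and> B_seq a b f \<in> l1w w},
      op_app = B_seq a b\<rparr>"

definition G_op :: "(nat \<Rightarrow> real) \<Rightarrow> (nat \<Rightarrow> real) \<Rightarrow> (nat \<Rightarrow> nat \<Rightarrow> real) \<Rightarrow> seq_operator" where
  "G_op w a b = op_closure w (op_add (A_op w a) (B_op w a b))"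

end

theory Submission
  imports Defs
begin

text \<open>
  Put \<open>T = A + B\<close>. If \<open>f\<close> lies in the domain of \<open>T\<close> and \<open>\<alpha> = a \<bar>f\<bar>\<close>, then
  \<open>\<alpha>\<^sub>n \<le> \<bar>(T f)\<^sub>n\<bar> + (\<Sum>j. b\<^sub>n\<^sub>j \<alpha>\<^sub>j)\<close>. Multiplying by \<open>w\<^sub>n\<close>, summing over \<open>n > N\<close> only
  and using the column bound \<open>(\<Sum>n<j. w\<^sub>n b\<^sub>n\<^sub>j) \<le> w\<^sub>j\<close> leaves exactly the rows \<open>n \<le> N\<close>, so that
  \<open>w\<^sub>N (\<Sum>j. a\<^sub>j b\<^sub>N\<^sub>j \<bar>f\<^sub>j\<bar>)\<close> is at most the norm of \<open>T f\<close>. Hence convergence of \<open>T f\<^sub>k\<close> in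
  norm makes every row series converge absolutely, uniformly in \<open>k\<close>, even in the critical case
  \<open>\<kappa> = 1\<close> where \<open>A f\<^sub>k\<close> itself need not converge.
\<close>

section \<open>The weighted space in terms of ordinary series\<close>

text \<open>The value \<open>w 0\<close> may have any sign. The normalisation \<open>f 0 = 0\<close>
  kills the term at index 0, so the unordered sum over \<open>{1..}\<close> becomes a series of
  non-negative terms over all of \<open>nat\<close>.\<close>

lemma l1w_iff_summable:
  assumes "\<And>n. n \<ge> 1 \<Longrightarrow> w n > 0"
  shows "f \<in> l1w w \<longleftrightarrow> f 0 = 0 \<and> summable (\<lambda>n. w n * \<bar>f n\<bar>)"
proof -
  have "(\<lambda>n. w n * \<bar>f n\<bar>) summable_on {1..} \<longleftrightarrow> summable (\<lambda>n. w n * \<bar>f n\<bar>)" if "f 0 = 0"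
  proof -
    have "(\<lambda>n. w n * \<bar>f n\<bar>) summable_on {1..} \<longleftrightarrow> (\<lambda>n. w n * \<bar>f n\<bar>) summable_on UNIV"
      using that by (intro summable_on_cong_neutral) (auto simp: not_le)
    also have "\<dots> \<longleftrightarrow> summable (\<lambda>n. w n * \<bar>f n\<bar>)"
    proof (rule summable_on_UNIV_nonneg_real_iff)
      fix n show "0 \<le> w n * \<bar>f n\<bar>"
        using assms[of n] that by (cases "n = 0") auto
    qed
    finally show ?thesis .
  qed
  then show ?thesis by (auto simp: l1w_def)
qed

lemma normw_eq_suminf:
  assumes "\<And>n. n \<ge> 1 \<Longrightarrow> w n > 0" and f: "f \<in> l1w w"
  shows "normw w f = (\<Sum>n. w n * \<bar>f n\<bar>)"
proof -
  have f0: "f 0 = 0" and s: "summable (\<lambda>n. w n * \<bar>f n\<bar>)"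
    using f l1w_iff_summable[OF assms(1)] by auto
  have "0 \<le> w n * \<bar>f n\<bar>" for n
    using assms(1)[of n] f0 by (cases "n = 0") auto
  then have "((\<lambda>n. w n * \<bar>f n\<bar>) has_sum (\<Sum>n. w n * \<bar>f n\<bar>)) UNIV"
    by (intro norm_summable_imp_has_sum) (use s in \<open>auto intro: summable_sums\<close>)
  then have "((\<lambda>n. w n * \<bar>f n\<bar>) has_sum (\<Sum>n. w n * \<bar>f n\<bar>)) {1..}"
    by (rule has_sum_cong_neutral[THEN iffD1, rotated -1]) (use f0 in \<open>auto simp: not_le\<close>)
  then show ?thesis
    unfolding normw_def by (rule infsumI)
qed

lemma abs_le_normw:
  assumes w: "\<And>n. n \<ge> 1 \<Longrightarrow> w n > 0" and f: "f \<in> l1w w" and "n \<ge> 1"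
  shows "w n * \<bar>f n\<bar> \<le> normw w f"
proof -
  have f0: "f 0 = 0" and s: "summable (\<lambda>n. w n * \<bar>f n\<bar>)"
    using f l1w_iff_summable[OF w] by auto
  have "0 \<le> w n * \<bar>f n\<bar>" for n
    using w[of n] f0 by (cases "n = 0") auto
  then have "(\<Sum>i\<in>{n}. w i * \<bar>f i\<bar>) \<le> (\<Sum>i. w i * \<bar>f i\<bar>)"
    by (intro sum_le_suminf s) auto
  then show ?thesis
    using normw_eq_suminf[OF w f] by simp
qed

lemma tendsto_coord:
  assumes w: "\<And>n. n \<ge> 1 \<Longrightarrow> w n > 0" and g: "g \<in> l1w w" and "\<And>k. f k \<in> l1w w"
    and lim: "(\<lambda>k. distw w g (f k)) \<longlonglongrightarrow> 0" and n: "n \<ge> 1"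
  shows "(\<lambda>k. f k n) \<longlonglongrightarrow> g n"
proof -
  have "norm (f k n - g n) \<le> distw w g (f k) / w n" for k
    using abs_le_normw[OF w l1w_diff[OF w g assms(3)] n, of k] w[OF n]
    by (simp add: distw_def pos_le_divide_eq mult.commute abs_minus_commute)
  moreover have "(\<lambda>k. distw w g (f k) / w n) \<longlonglongrightarrow> 0"
    using tendsto_divide[OF lim tendsto_const[of "w n"]] w[OF n] by simp
  ultimately have "(\<lambda>k. f k n - g n) \<longlonglongrightarrow> 0"
    by (rule Lim_null_comparison[OF always_eventually[OF allI]])
  then show ?thesis by (simp add: LIM_zero_iff)
qed

section \<open>Closures of graphs through sequences\<close>

lemma closure_graph_carrier:
  assumes w: "\<And>n. n \<ge> 1 \<Longrightarrow> w n > 0" and gh: "(g, h) \<in> closure_graph w T"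
  shows "g \<in> l1w w" "h \<in> l1w w"
proof -
  interpret M: Metric_space "l1w w" "distw w"
    by (rule Metric_space_l1w[OF w])
  show "g \<in> l1w w" "h \<in> l1w w"
    using gh by (auto simp: closure_graph_def topw_def in_closure_of)
qed

text \<open>Products of two balls of radius \<open>1/(k+1)\<close> are open rectangles around the
  point, and each meets the graph. Membership in the balls also places \<open>f k\<close> and its
  image in the space, which \<open>op_dom T\<close> alone does not guarantee for a general
  \<open>T\<close>.\<close>

lemma closure_graph_sequence:
  assumes w: "\<And>n. n \<ge> 1 \<Longrightarrow> w n > 0" and gh: "(g, h) \<in> closure_graph w T"
  shows "\<exists>f. (\<forall>k. f k \<in> op_dom T \<and> f k \<in> l1w w \<and> op_app T (f k) \<in> l1w w) \<and>
    (\<lambda>k. distw w g (f k)) \<longlonglongrightarrow> 0 \<and> (\<lambda>k. distw w h (op_app T (f k))) \<longlonglongrightarrow> 0"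
proof -
  interpret M: Metric_space "l1w w" "distw w"
    by (rule Metric_space_l1w[OF w])
  have *: "(g, h) \<in> prod_topology M.mtopology M.mtopology closure_of op_graph T"
    using gh by (simp add: closure_graph_def topw_def)
  note g = closure_graph_carrier(1)[OF w gh] and h = closure_graph_carrier(2)[OF w gh]
  have "\<exists>f. f \<in> op_dom T \<and> f \<in> l1w w \<and> op_app T f \<in> l1w w \<and>
      distw w g f < e \<and> distw w h (op_app T f) < e" if "e > 0" for e
  proof -
    have "openin (prod_topology M.mtopology M.mtopology) (M.mball g e \<times> M.mball h e)"
      by (auto simp: openin_prod_Times_iff)
    moreover have "(g, h) \<in> M.mball g e \<times> M.mball h e"
      using g h that by simp
    ultimately obtain p where "p \<in> op_graph T" "p \<in> M.mball g e \<times> M.mball h e"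
      using *[unfolded in_closure_of, THEN conjunct2, rule_format,
          of "M.mball g e \<times> M.mball h e"] by auto
    then show ?thesis by (auto simp: op_graph_def)
  qed
  then have "\<forall>k. \<exists>f. f \<in> op_dom T \<and> f \<in> l1w w \<and> op_app T f \<in> l1w w \<and>
      distw w g f < inverse (real (Suc k)) \<and> distw w h (op_app T f) < inverse (real (Suc k))"
    by simp
  from choice[OF this]
  obtain f where f: "\<And>k. f k \<in> op_dom T" "\<And>k. f k \<in> l1w w" "\<And>k. op_app T (f k) \<in> l1w w"
    and d: "\<And>k. distw w g (f k) < inverse (real (Suc k))"
      "\<And>k. distw w h (op_app T (f k)) < inverse (real (Suc k))"
    by auto
  have "(\<lambda>k. distw w g (f k)) \<longlonglongrightarrow> 0"
    by (rule tendsto_sandwich[OF always_eventually always_eventually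
        tendsto_const LIMSEQ_inverse_real_of_nat]) (auto simp del: of_nat_Suc intro: less_imp_le d)
  moreover have "(\<lambda>k. distw w h (op_app T (f k))) \<longlonglongrightarrow> 0"
    by (rule tendsto_sandwich[OF always_eventually always_eventually
        tendsto_const LIMSEQ_inverse_real_of_nat]) (auto simp del: of_nat_Suc intro: less_imp_le d)
  ultimately show ?thesis using f by (intro exI[of _ f] conjI allI)
qed

section \<open>Row estimate for strictly upper triangular matrices\<close>

text \<open>The column bound has the constant 1, to which every \<kappa> in (0,1] reduces. The
  coefficients \<open>a\<close> are kept apart: the estimates below concern the matrix
  \<open>b\<close> acting on a non-negative sequence \<alpha>.\<close>

locale subtriangular =
  fixes w :: "nat \<Rightarrow> real" and b :: "nat \<Rightarrow> nat \<Rightarrow> real"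
  assumes w_pos: "n \<ge> 1 \<Longrightarrow> w n > 0"
    and b_nonneg: "n \<ge> 1 \<Longrightarrow> j \<ge> 1 \<Longrightarrow> b n j \<ge> 0"
    and b_zero: "n \<ge> 1 \<Longrightarrow> j \<ge> 1 \<Longrightarrow> n \<ge> j \<Longrightarrow> b n j = 0"
    and column_le: "j \<ge> 2 \<Longrightarrow> (\<Sum>n=1..j-1. w n * b n j) \<le> w j"
begin

text \<open>Arbitrary finite sets of rows are allowed because entries on and below the diagonal
  vanish and the others are non-negative. It is applied to one row and to row \<open>N\<close>
  together with finitely many later rows.\<close>

lemma sum_column_le:
  assumes F: "finite F" "F \<subseteq> {1..}" and j: "j \<ge> 1"
  shows "(\<Sum>n\<in>F. w n * b n j) \<le> w j"
proof (cases "j = 1")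
  case True
  then have "(\<Sum>n\<in>F. w n * b n j) = 0"
    using F by (intro sum.neutral) (auto simp: b_zero)
  then show ?thesis using w_pos[OF j] by simp
next
  case False
  have nonneg: "0 \<le> w n * b n j" if "n \<ge> 1" for n
    using w_pos[OF that] b_nonneg[OF that j] by simp
  have "(\<Sum>n\<in>F. w n * b n j) = (\<Sum>n\<in>F \<inter> {1..j-1}. w n * b n j)"
  proof (rule sum.mono_neutral_right)
    show "\<forall>n\<in>F - F \<inter> {1..j-1}. w n * b n j = 0"
    proof
      fix n assume "n \<in> F - F \<inter> {1..j-1}"
      then have "n \<ge> 1" "n \<ge> j" using F by auto
      then show "w n * b n j = 0" using j by (simp add: b_zero)
    qed
  qed (use F in auto)
  also have "\<dots> \<le> (\<Sum>n=1..j-1. w n * b n j)"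
    by (rule sum_mono2) (auto intro: nonneg)
  also have "\<dots> \<le> w j"
    using j False by (intro column_le) auto
  finally show ?thesis .
qed

lemma summable_row:
  assumes \<alpha>: "\<alpha> 0 = 0" "\<And>j. 0 \<le> \<alpha> j" "summable (\<lambda>j. w j * \<alpha> j)" and n: "n \<ge> 1"
  shows "summable (\<lambda>j. b n j * \<alpha> j)"
proof (rule summable_comparison_test')
  show "summable (\<lambda>j. w j * \<alpha> j / w n)"
    by (rule summable_divide[OF \<alpha>(3)])
  fix j
  show "norm (b n j * \<alpha> j) \<le> w j * \<alpha> j / w n"
  proof (cases "j = 0")
    case False
    then have j: "j \<ge> 1" by simp
    have "w n * b n j \<le> w j"
      using sum_column_le[of "{n}" j] n j by simp
    then have "w n * b n j * \<alpha> j \<le> w j * \<alpha> j"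
      using \<alpha>(2) by (rule mult_right_mono)
    then show ?thesis
      using w_pos[OF n] b_nonneg[OF n j] \<alpha>(2)[of j]
      by (simp add: pos_le_divide_eq mult_ac abs_mult)
  qed (simp add: \<alpha>)
qed

text \<open>The weighted mass of \<alpha> beyond \<open>N\<close> appears on both sides of the
  summed inequality. It is finite because \<open>w j * \<alpha> j\<close> is summable, so it cancels
  and leaves row \<open>N\<close>.\<close>

lemma row_estimate:
  assumes \<alpha>: "\<alpha> 0 = 0" "\<And>j. 0 \<le> \<alpha> j" "summable (\<lambda>j. w j * \<alpha> j)"
    and u: "u \<in> l1w w"
    and le: "\<And>n. n \<ge> 1 \<Longrightarrow> \<alpha> n \<le> \<bar>u n\<bar> + (\<Sum>j. b n j * \<alpha> j)" and N: "N \<ge> 1"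
  shows "w N * (\<Sum>j. b N j * \<alpha> j) \<le> normw w u"
proof -
  define \<beta> where "\<beta> = (\<lambda>j. if N < j then w j * \<alpha> j else 0)"
  have u0: "u 0 = 0" and us: "summable (\<lambda>n. w n * \<bar>u n\<bar>)"
    using u l1w_iff_summable[OF w_pos] by auto
  have u_nonneg: "0 \<le> w n * \<bar>u n\<bar>" for n
    using w_pos[of n] u0 by (cases "n = 0") auto
  have w\<alpha>: "0 \<le> w n * \<alpha> n" for n
    using w_pos[of n] \<alpha>(1,2) by (cases "n = 0") auto
  have \<beta>_nonneg: "0 \<le> \<beta> j" for j
    using w\<alpha> by (simp add: \<beta>_def)
  have \<beta>: "summable \<beta>"
    by (rule summable_comparison_test'[OF \<alpha>(3)]) (use w\<alpha> in \<open>auto simp: \<beta>_def\<close>)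
  have row: "summable (\<lambda>j. b n j * \<alpha> j)" if "n \<ge> 1" for n
    using summable_row[OF \<alpha> that] .
  \<comment> \<open>Only the finitely many rows strictly between \<open>N\<close> and
    \<open>M\<close> are summed, so interchanging the row sum with the series over \<open>j\<close>
    is elementary; the passage to all \<open>M\<close> comes last.\<close>
  have bound: "sum \<beta> {..<M} \<le> normw w u + (suminf \<beta> - w N * (\<Sum>j. b N j * \<alpha> j))" for M
  proof -
    define F where "F = {N<..<M}"
    have F: "finite F" "F \<subseteq> {1..}" "N \<notin> F" using N by (auto simp: F_def)
    \<comment> \<open>For \<open>j > N\<close>, the rows in \<open>F\<close> and row
      \<open>N\<close> share the single budget \<open>w j\<close> of column \<open>j\<close>, and
      row \<open>N\<close> is moved to the right. For \<open>j \<le> N\<close> all terms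
      vanish.\<close>
    have termwise: "(\<Sum>n\<in>F. w n * (b n j * \<alpha> j)) \<le> \<beta> j - w N * (b N j * \<alpha> j)" for j
    proof (cases "N < j")
      case True
      have "(\<Sum>n\<in>insert N F. w n * b n j) \<le> w j"
        using True F N by (intro sum_column_le) auto
      then have "((\<Sum>n\<in>F. w n * b n j) + w N * b N j) * \<alpha> j \<le> w j * \<alpha> j"
        using F \<alpha>(2) by (intro mult_right_mono) auto
      then show ?thesis
        using True by (simp add: \<beta>_def algebra_simps sum_distrib_right sum_distrib_left)
    next
      case False
      have "b n j * \<alpha> j = 0" if "n \<ge> N" for n
        using False b_zero[of n j] that N \<alpha>(1) by (cases "j = 0") auto
      then have "(\<Sum>n\<in>F. w n * (b n j * \<alpha> j)) = 0" "w N * (b N j * \<alpha> j) = 0"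
        by (simp_all add: F_def sum.neutral del: mult_eq_0_iff)
      then show ?thesis
        using False unfolding \<beta>_def by (simp only: if_False)
    qed
    have "sum \<beta> {..<M} = (\<Sum>n\<in>F. w n * \<alpha> n)"
      unfolding F_def by (rule sum.mono_neutral_cong_right) (auto simp: \<beta>_def)
    also have "\<dots> \<le> (\<Sum>n\<in>F. w n * \<bar>u n\<bar> + w n * (\<Sum>j. b n j * \<alpha> j))"
    proof (rule sum_mono)
      fix n assume "n \<in> F"
      then have "n \<ge> 1" using F by auto
      from mult_left_mono[OF le[OF this] less_imp_le[OF w_pos[OF this]]]
      show "w n * \<alpha> n \<le> w n * \<bar>u n\<bar> + w n * (\<Sum>j. b n j * \<alpha> j)"
        by (simp add: distrib_left)
    qed
    also have "\<dots> = (\<Sum>n\<in>F. w n * \<bar>u n\<bar>) + (\<Sum>n\<in>F. \<Sum>j. w n * (b n j * \<alpha> j))"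
      unfolding sum.distrib using F
      by (intro arg_cong2[where f = "(+)"] refl sum.cong suminf_mult[symmetric] row) auto
    also have "(\<Sum>n\<in>F. \<Sum>j. w n * (b n j * \<alpha> j)) = (\<Sum>j. \<Sum>n\<in>F. w n * (b n j * \<alpha> j))"
      using F by (intro suminf_sum[symmetric] summable_mult row) auto
    also have "\<dots> \<le> (\<Sum>j. \<beta> j - w N * (b N j * \<alpha> j))"
      using F by (intro suminf_le termwise summable_sum summable_diff \<beta> summable_mult row N) auto
    also have "\<dots> = suminf \<beta> - w N * (\<Sum>j. b N j * \<alpha> j)"
      using suminf_diff[OF \<beta> summable_mult[OF row[OF N], of "w N"]] suminf_mult[OF row[OF N]]
      by simp
    finally have "sum \<beta> {..<M} \<le>
        (\<Sum>n\<in>F. w n * \<bar>u n\<bar>) + (suminf \<beta> - w N * (\<Sum>j. b N j * \<alpha> j))" by simp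
    moreover have "(\<Sum>n\<in>F. w n * \<bar>u n\<bar>) \<le> (\<Sum>n. w n * \<bar>u n\<bar>)"
      by (rule sum_le_suminf[OF us]) (use F u_nonneg in auto)
    ultimately show ?thesis
      using normw_eq_suminf[where w = w, OF w_pos u] by simp
  qed
  have "suminf \<beta> \<le> normw w u + (suminf \<beta> - w N * (\<Sum>j. b N j * \<alpha> j))"
    by (rule suminf_le_const[OF \<beta> bound])
  then show ?thesis by simp
qed

end

section \<open>The sum of \<open>A_op\<close> and \<open>B_op\<close> on its domain\<close>

locale fragmentation = subtriangular +
  fixes a :: "nat \<Rightarrow> real"
  assumes a_nonneg: "n \<ge> 1 \<Longrightarrow> a n \<ge> 0"
begin

abbreviation T_op :: seq_operator where
  "T_op \<equiv> op_add (A_op w a) (B_op w a b)"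

text \<open>
  In a row series the terms with \<open>j \<le> n\<close> vanish, so the shifted series of the definitions may be
  taken over all of \<^typ>\<open>nat\<close>.
\<close>

lemma row_shift:
  assumes "f 0 = 0" "n \<ge> 1"
  shows "summable (\<lambda>i. a (n + 1 + i) * b n (n + 1 + i) * f (n + 1 + i)) \<longleftrightarrow>
      summable (\<lambda>j. a j * b n j * f j)"
    and "(\<Sum>i. a (n + 1 + i) * b n (n + 1 + i) * f (n + 1 + i)) = (\<Sum>j. a j * b n j * f j)"
proof -
  have "a j * b n j * f j = 0" if "j < n + 1" for j
    using b_zero[of n j] assms that by (cases "j = 0") auto
  then have sums: "(\<lambda>i. a (n + 1 + i) * b n (n + 1 + i) * f (n + 1 + i)) sums s \<longleftrightarrow>
      (\<lambda>j. a j * b n j * f j) sums s" for s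
    using sums_zero_iff_shift[of "n + 1" "\<lambda>j. a j * b n j * f j" s] by (simp add: add_ac)
  show "summable (\<lambda>i. a (n + 1 + i) * b n (n + 1 + i) * f (n + 1 + i)) \<longleftrightarrow>
      summable (\<lambda>j. a j * b n j * f j)"
    unfolding summable_def sums ..
  show "(\<Sum>i. a (n + 1 + i) * b n (n + 1 + i) * f (n + 1 + i)) = (\<Sum>j. a j * b n j * f j)"
    unfolding suminf_def sums ..
qed

lemma T_app:
  assumes "f 0 = 0" "n \<ge> 1"
  shows "op_app T_op f n = - a n * f n + (\<Sum>j. a j * b n j * f j)"
  using row_shift(2)[of f n] assms by (simp add: op_add_def A_op_def B_op_def B_seq_def)

lemma T_row_abs_summable:
  assumes f: "f \<in> l1w w" "(\<lambda>n. a n * f n) \<in> l1w w" and n: "n \<ge> 1"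
  shows "summable (\<lambda>j. \<bar>a j * b n j * f j\<bar>)"
    and "(\<Sum>j. \<bar>a j * b n j * f j\<bar>) = (\<Sum>j. b n j * \<bar>a j * f j\<bar>)"
proof -
  have f0: "f 0 = 0" and s: "summable (\<lambda>n. w n * \<bar>a n * f n\<bar>)"
    using f l1w_iff_summable[OF w_pos] by auto
  \<comment> \<open>The sign of \<open>b n 0\<close> is unspecified; there \<open>f 0 = 0\<close>
    makes both sides zero.\<close>
  have eq: "\<bar>a j * b n j * f j\<bar> = b n j * \<bar>a j * f j\<bar>" for j
    using b_nonneg[OF n, of j] f0 by (cases "j = 0") (auto simp: abs_mult)
  show "summable (\<lambda>j. \<bar>a j * b n j * f j\<bar>)"
    unfolding eq by (rule summable_row[OF _ _ s n]) (auto simp: f0)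
  show "(\<Sum>j. \<bar>a j * b n j * f j\<bar>) = (\<Sum>j. b n j * \<bar>a j * f j\<bar>)"
    unfolding eq ..
qed

text \<open>This is \<open>row_estimate\<close> with \<alpha> the sequence
  \<open>\<bar>a j * f j\<bar>\<close>, whose weighted summability is the condition for the domain
  of \<open>A_op\<close>. The inequality required of \<alpha> is the triangle inequality for
  \<open>a n * f n\<close>, written as its row series minus the value of
  \<open>T_op\<close>.\<close>

lemma T_row_estimate:
  assumes f: "f \<in> l1w w" "(\<lambda>n. a n * f n) \<in> l1w w" and T: "op_app T_op f \<in> l1w w" and N: "N \<ge> 1"
  shows "w N * (\<Sum>j. \<bar>a j * b N j * f j\<bar>) \<le> normw w (op_app T_op f)"
  unfolding T_row_abs_summable(2)[OF f N]
proof (rule row_estimate[OF _ _ _ T _ N])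
  show f0: "\<bar>a 0 * f 0\<bar> = 0" and "summable (\<lambda>n. w n * \<bar>a n * f n\<bar>)"
    using f l1w_iff_summable[OF w_pos] by auto
  fix n :: nat assume n: "n \<ge> 1"
  have "\<bar>\<Sum>j. a j * b n j * f j\<bar> \<le> (\<Sum>j. b n j * \<bar>a j * f j\<bar>)"
    using summable_rabs[OF T_row_abs_summable(1)[OF f n]] T_row_abs_summable(2)[OF f n] by simp
  moreover have "op_app T_op f n = - a n * f n + (\<Sum>j. a j * b n j * f j)"
    using f n by (intro T_app) (auto simp: l1w_def)
  ultimately show "\<bar>a n * f n\<bar> \<le> \<bar>op_app T_op f n\<bar> + (\<Sum>j. b n j * \<bar>a j * f j\<bar>)"
    by simp
qed simp

text \<open>Makes \<open>T_row_estimate\<close> applicable to differences of approximating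
  sequences. Absolute convergence of the rows permits splitting the series.\<close>

lemma T_dom_diff:
  assumes "f \<in> op_dom T_op" "g \<in> op_dom T_op"
  shows "(\<lambda>n. f n - g n) \<in> l1w w" "(\<lambda>n. a n * (f n - g n)) \<in> l1w w"
    "op_app T_op (\<lambda>n. f n - g n) = (\<lambda>n. op_app T_op f n - op_app T_op g n)"
proof -
  have f: "f \<in> l1w w" "(\<lambda>n. a n * f n) \<in> l1w w" and g: "g \<in> l1w w" "(\<lambda>n. a n * g n) \<in> l1w w"
    using assms by (auto simp: op_add_def A_op_def)
  show "(\<lambda>n. f n - g n) \<in> l1w w"
    by (rule l1w_diff[OF w_pos f(1) g(1)])
  show "(\<lambda>n. a n * (f n - g n)) \<in> l1w w"
    using l1w_diff[OF w_pos f(2) g(2)] by (simp add: right_diff_distrib)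
  show "op_app T_op (\<lambda>n. f n - g n) = (\<lambda>n. op_app T_op f n - op_app T_op g n)"
  proof
    fix n
    have f0: "f 0 = 0" "g 0 = 0" using f g by (auto simp: l1w_def)
    show "op_app T_op (\<lambda>n. f n - g n) n = op_app T_op f n - op_app T_op g n"
    proof (cases "n = 0")
      case True
      then show ?thesis using f0 by (simp add: op_add_def A_op_def B_op_def B_seq_def)
    next
      case False
      then have n: "n \<ge> 1" by simp
      have "(\<Sum>j. a j * b n j * (f j - g j)) = (\<Sum>j. a j * b n j * f j) - (\<Sum>j. a j * b n j * g j)"
        using suminf_diff[OF summable_rabs_cancel[OF T_row_abs_summable(1)[OF f n]]
            summable_rabs_cancel[OF T_row_abs_summable(1)[OF g n]]]
        by (simp add: right_diff_distrib)
      then show ?thesis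
        using n f0 by (simp add: T_app algebra_simps)
    qed
  qed
qed

section \<open>Passage to the closure\<close>

text \<open>The row estimate turns convergence of the images into a Cauchy bound for each row, in
  absolute sums. A Fatou-type argument transfers the bound to \<open>g\<close>, so the row series of
  \<open>f k\<close> converge to that of \<open>g\<close>.\<close>

lemma closure_T_app:
  assumes gh: "(g, h) \<in> closure_graph w T_op" and n: "n \<ge> 1"
  shows "summable (\<lambda>j. a j * b n j * g j)"
    and "h n = - a n * g n + (\<Sum>j. a j * b n j * g j)"
proof -
  interpret M: Metric_space "l1w w" "distw w"
    by (rule Metric_space_l1w[OF w_pos])
  note g = closure_graph_carrier(1)[OF w_pos gh] and h = closure_graph_carrier(2)[OF w_pos gh]
  obtain f where dom: "\<And>k. f k \<in> op_dom T_op"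
    and fl: "\<And>k. f k \<in> l1w w" and Tl: "\<And>k. op_app T_op (f k) \<in> l1w w"
    and limf: "(\<lambda>k. distw w g (f k)) \<longlonglongrightarrow> 0"
    and limT: "(\<lambda>k. distw w h (op_app T_op (f k))) \<longlonglongrightarrow> 0"
    using closure_graph_sequence[OF w_pos gh] by auto
  have af: "(\<lambda>n. a n * f k n) \<in> l1w w" for k
    using dom[of k] by (auto simp: op_add_def A_op_def)
  have zero: "f k 0 = 0" "g 0 = 0" for k
    using fl[of k] g by (auto simp: l1w_def)
  have f_coord: "(\<lambda>k. f k j) \<longlonglongrightarrow> g j" for j
    using tendsto_coord[OF w_pos g fl limf, of j] zero by (cases "j = 0") auto
  define d where "d = (\<lambda>k. distw w h (op_app T_op (f k)))"
  \<comment> \<open>Stated for partial sums because the limit in \<open>l\<close> is known only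
    coordinate by coordinate; the bound is uniform in \<open>M\<close>.\<close>
  have Cauchy: "(\<Sum>j<M. \<bar>a j * b n j * (f l j - f k j)\<bar>) \<le> (d l + d k) / w n" for k l M
  proof -
    note diff = T_dom_diff[OF dom[of l] dom[of k]]
    have Tdiff: "op_app T_op (\<lambda>n. f l n - f k n) \<in> l1w w"
      unfolding diff(3) by (rule l1w_diff[OF w_pos Tl Tl])
    have "w n * (\<Sum>j<M. \<bar>a j * b n j * (f l j - f k j)\<bar>) \<le>
        w n * (\<Sum>j. \<bar>a j * b n j * (f l j - f k j)\<bar>)"
      using w_pos[OF n] T_row_abs_summable(1)[OF diff(1,2) n]
      by (intro mult_left_mono sum_le_suminf) auto
    also have "\<dots> \<le> distw w (op_app T_op (f l)) (op_app T_op (f k))"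
      using T_row_estimate[OF diff(1,2) Tdiff n] unfolding diff(3) distw_def .
    also have "\<dots> \<le> d l + d k"
      using M.triangle[OF Tl[of l] h Tl[of k]] by (simp add: d_def M.commute)
    finally show ?thesis
      using w_pos[OF n] by (simp add: pos_le_divide_eq mult.commute)
  qed
  have limit: "(\<Sum>j<M. \<bar>a j * b n j * (g j - f k j)\<bar>) \<le> d k / w n" for k M
  proof (rule LIMSEQ_le)
    show "(\<lambda>l. \<Sum>j<M. \<bar>a j * b n j * (f l j - f k j)\<bar>)
        \<longlonglongrightarrow> (\<Sum>j<M. \<bar>a j * b n j * (g j - f k j)\<bar>)"
      by (intro tendsto_intros f_coord)
    have "(\<lambda>l. (d l + d k) / w n) \<longlonglongrightarrow> (0 + d k) / w n"
      using w_pos[OF n] limT by (intro tendsto_intros) (auto simp: d_def)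
    then show "(\<lambda>l. (d l + d k) / w n) \<longlonglongrightarrow> d k / w n" by simp
    show "\<exists>L. \<forall>l\<ge>L. (\<Sum>j<M. \<bar>a j * b n j * (f l j - f k j)\<bar>) \<le> (d l + d k) / w n"
      using Cauchy by blast
  qed
  have abs_sum: "summable (\<lambda>j. \<bar>a j * b n j * (g j - f k j)\<bar>)" for k
    by (rule summableI_nonneg_bounded[OF _ limit]) simp
  have f_sum: "summable (\<lambda>j. a j * b n j * f k j)" for k
    by (rule summable_rabs_cancel[OF T_row_abs_summable(1)[OF fl af n]])
  \<comment> \<open>Here \<open>g\<close> is split as \<open>(g - f 0) + f 0\<close>, where
    \<open>f 0\<close> is the first approximant.\<close>
  show g_sum: "summable (\<lambda>j. a j * b n j * g j)"
    using summable_add[OF summable_rabs_cancel[OF abs_sum[of 0]] f_sum[of 0]]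
    by (simp add: right_diff_distrib)
  have "norm ((\<Sum>j. a j * b n j * f k j) - (\<Sum>j. a j * b n j * g j)) \<le> d k / w n" for k
  proof -
    have "\<bar>\<Sum>j. a j * b n j * (g j - f k j)\<bar> \<le> (\<Sum>j. \<bar>a j * b n j * (g j - f k j)\<bar>)"
      by (rule summable_rabs[OF abs_sum])
    also have "\<dots> \<le> d k / w n"
      by (rule suminf_le_const[OF abs_sum limit])
    finally show ?thesis
      using suminf_diff[OF g_sum f_sum[of k]]
      by (simp add: right_diff_distrib abs_minus_commute)
  qed
  moreover have "(\<lambda>k. d k / w n) \<longlonglongrightarrow> 0"
    using tendsto_divide[OF limT tendsto_const[of "w n"]] w_pos[OF n] by (simp add: d_def)
  ultimately have "(\<lambda>k. (\<Sum>j. a j * b n j * f k j) - (\<Sum>j. a j * b n j * g j)) \<longlonglongrightarrow> 0"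
    by (rule Lim_null_comparison[OF always_eventually[OF allI]])
  \<comment> \<open>The \<open>n\<close>-th coordinates of the images have two limits: the desired
    formula, and \<open>h n\<close> by norm convergence.\<close>
  then have "(\<lambda>k. - a n * f k n + (\<Sum>j. a j * b n j * f k j))
      \<longlonglongrightarrow> - a n * g n + (\<Sum>j. a j * b n j * g j)"
    by (intro tendsto_intros f_coord) (simp add: LIM_zero_iff)
  moreover have "(\<lambda>k. - a n * f k n + (\<Sum>j. a j * b n j * f k j)) \<longlonglongrightarrow> h n"
    using tendsto_coord[OF w_pos h Tl limT n] by (simp only: T_app zero n)
  ultimately show "h n = - a n * g n + (\<Sum>j. a j * b n j * g j)"
    using LIMSEQ_unique by blast
qed

text \<open>This is closability: \<open>g\<close> determines every coordinate of \<open>h\<close>,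
  and index 0 is fixed by the normalisation.\<close>

lemma closure_T_unique:
  assumes "(g, h) \<in> closure_graph w T_op" "(g, h') \<in> closure_graph w T_op"
  shows "h = h'"
proof
  fix n
  have "h 0 = 0" "h' 0 = 0"
    using closure_graph_carrier(2)[OF w_pos assms(1)] closure_graph_carrier(2)[OF w_pos assms(2)]
    by (simp_all add: l1w_def)
  then show "h n = h' n"
    using closure_T_app(2)[OF assms(1)] closure_T_app(2)[OF assms(2)] by (cases "n = 0") auto
qed

end

theorem theorem4p2:
  fixes a :: "nat \<Rightarrow> real" and b :: "nat \<Rightarrow> nat \<Rightarrow> real" and w :: "nat \<Rightarrow> real"
  assumes a_nonneg: "\<And>n. n \<ge> 1 \<Longrightarrow> a n \<ge> 0"
    and b_nonneg: "\<And>n j. n \<ge> 1 \<Longrightarrow> j \<ge> 1 \<Longrightarrow> b n j \<ge> 0"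
    and b_zero: "\<And>n j. n \<ge> 1 \<Longrightarrow> j \<ge> 1 \<Longrightarrow> n \<ge> j \<Longrightarrow> b n j = 0"
    and w_pos: "\<And>n. n \<ge> 1 \<Longrightarrow> w n > 0"
    and w_ge: "\<And>n. n \<ge> 1 \<Longrightarrow> w n \<ge> real n"
    and kappa: "\<exists>\<kappa>. 0 < \<kappa> \<and> \<kappa> \<le> 1 \<and> (\<forall>j\<ge>2. (\<Sum>n=1..j-1. w n * b n j) \<le> \<kappa> * w j)"
  shows "\<forall>g \<in> op_dom (G_op w a b). \<forall>n\<ge>1.
           summable (\<lambda>i. a (n + 1 + i) * b n (n + 1 + i) * g (n + 1 + i)) \<and>
           op_app (G_op w a b) g n =
             - a n * g n + (\<Sum>i. a (n + 1 + i) * b n (n + 1 + i) * g (n + 1 + i))"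
proof (intro ballI allI impI)
  obtain \<kappa> where \<kappa>: "\<kappa> \<le> 1" "\<And>j. j \<ge> 2 \<Longrightarrow> (\<Sum>n=1..j-1. w n * b n j) \<le> \<kappa> * w j"
    using kappa by blast
  interpret fragmentation w b a
  proof
    fix j :: nat assume j: "j \<ge> 2"
    have "\<kappa> * w j \<le> 1 * w j"
      using \<kappa>(1) w_pos[of j] j by (intro mult_right_mono) auto
    with \<kappa>(2)[OF j] show "(\<Sum>n=1..j-1. w n * b n j) \<le> w j" by simp
  qed (use a_nonneg b_nonneg b_zero w_pos in auto)
  fix g and n :: nat
  assume "g \<in> op_dom (G_op w a b)" and n: "n \<ge> 1"
  then obtain h where h: "(g, h) \<in> closure_graph w T_op"
    by (auto simp: G_op_def op_closure_def)
  \<comment> \<open>Single-valuedness of the closed graph makes the definite description in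
    \<open>op_closure\<close> pick out \<open>h\<close>.\<close>
  have "op_app (G_op w a b) g = h"
    using h by (simp add: G_op_def op_closure_def the_equality closure_T_unique)
  moreover have "g 0 = 0"
    using closure_graph_carrier(1)[OF w_pos h] by (simp add: l1w_def)
  ultimately show "summable (\<lambda>i. a (n + 1 + i) * b n (n + 1 + i) * g (n + 1 + i)) \<and>
      op_app (G_op w a b) g n =
        - a n * g n + (\<Sum>i. a (n + 1 + i) * b n (n + 1 + i) * g (n + 1 + i))"
    using closure_T_app[OF h n] row_shift[of g n] n by simp
qed

end
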